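(* Let $S_n$ be a symmetric group of degree $n$. If $\sigma\in S_n$, then (1) $\sigma\in PP_\lambda(S_n)$ if and only if $\sigma^{-1}\in PP_\lambda(S_n)$; (2) $\sigma\in PP_\rho(S_n)$ if and only if $\sigma^{-1}\in PP_\rho(S_n)$; (3) $I\in PP_\lambda(S_n)$, where $I$ is the identity permutation.
   Context: $S_n$ is the group of all permutations of $\{1,2,\dots,n\}$ under composition. For $\sigma\in S_n$, $N_\lambda(\sigma)=12\cdots n\,\sigma(n)\cdots\sigma(1)$ is the number obtained by writing $1,2,\dots,n,\sigma(n),\dots,\sigma(1)$ one after another, and $N_\rho(\sigma)=12\cdots n\,\sigma(1)\cdots\sigma(n)$ is the number obtained by writing $1,2,\dots,n,\sigma(1),\dots,\sigma(n)$ one after another. An integer is a palindrome if it reads the same forwards and backwards (for example, $12321$). $PP_\lambda(S_n)$ is the set of $\sigma\in S_n$ for which the number $N_\lambda(\sigma)$ is a palindrome (left palindromic permutations), and $PP_\rho(S_n)$ is the set of $\sigma\in S_n$ for which the number $N_\rho(\sigma)$ is a palindrome (right palindromic permutations).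
   Formalization: Numbers are written in a base b > n, so each entry 1,…,n is a single digit (for base ten: n ≤ 9); in decimal with n ≥ 10 the claim fails, e.g. for n = 10 the identity gives 1234567891010987654321, not a palindrome. *)

theory Defs
  imports "HOL-Algebra.Sym_Groups"
begin

text \<open>
  Numbers are written in a base \<open>b\<close>, most significant digit first. Base ten is the ordinary
  decimal notation. The base is a parameter because the results about palindromic permutations of
  \<open>{1..n}\<close> presuppose that every entry is a single digit, that is \<open>n < b\<close>. If entries may have
  several digits they fail: in base ten, the identity of degree 10 yields
  1234567891010987654321, which is not a palindrome; and for \<open>n = 21\<close> the only left palindromic
  permutation is the one whose values at 21, ..., 1 are
  1, 20, 2, 9, 18, 17, 16, 15, 14, 13, 12, 11, 10, 19, 8, 7, 6, 5, 4, 3, 21,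
  and it is not an involution.
\<close>

text \<open>The case \<open>b < 2\<close>, which is not a positional notation, only serves termination.\<close>

fun digits :: "nat \<Rightarrow> nat \<Rightarrow> nat list" where
  "digits b m = (if b < 2 \<or> m < b then [m] else digits b (m div b) @ [m mod b])"

declare digits.simps [simp del]

definition juxtapose :: "nat \<Rightarrow> nat list \<Rightarrow> nat" where
  "juxtapose b xs = horner_sum id b (rev (concat (map (digits b) xs)))"

definition palindrome :: "nat \<Rightarrow> nat \<Rightarrow> bool" where
  "palindrome b m \<longleftrightarrow> rev (digits b m) = digits b m"

definition N_left :: "nat \<Rightarrow> nat \<Rightarrow> (nat \<Rightarrow> nat) \<Rightarrow> nat" where
  "N_left b n \<sigma> = juxtapose b ([1..<Suc n] @ rev (map \<sigma> [1..<Suc n]))"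

definition N_right :: "nat \<Rightarrow> nat \<Rightarrow> (nat \<Rightarrow> nat) \<Rightarrow> nat" where
  "N_right b n \<sigma> = juxtapose b ([1..<Suc n] @ map \<sigma> [1..<Suc n])"

definition PP_left :: "nat \<Rightarrow> nat \<Rightarrow> (nat \<Rightarrow> nat) set" where
  "PP_left b n = {\<sigma> \<in> carrier (sym_group n). palindrome b (N_left b n \<sigma>)}"

definition PP_right :: "nat \<Rightarrow> nat \<Rightarrow> (nat \<Rightarrow> nat) set" where
  "PP_right b n = {\<sigma> \<in> carrier (sym_group n). palindrome b (N_right b n \<sigma>)}"

end

theory Submission
  imports Defs
begin

text \<open>
  As all entries are digits and the leading one is nonzero, a juxtaposition is a palindrome iff the
  list of its entries is. Writing \<open>w\<close> for the word \<open>1, \<dots>, n\<close>, left palindromic thus means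
  \<open>\<sigma>(w) = w\<close> and right palindromic means \<open>\<sigma>(w) = rev w\<close>. Applying \<open>\<sigma>\<close> once more gives
  \<open>\<sigma>\<^sup>2 = 1\<close> in both cases, so every palindromic permutation is its own inverse.
\<close>

lemma digits_less: "x < b \<Longrightarrow> digits b x = [x]"
  by (subst digits.simps) simp

text \<open>Covers base 0 as well, where \<open>digits_less\<close> does not apply to the number
  0.\<close>

lemma digits_0: "digits b 0 = [0]"
  by (subst digits.simps) auto

lemma juxtapose_digits:
  assumes "\<forall>x\<in>set xs. x < b"
  shows "juxtapose b xs = horner_sum id b (rev xs)"
proof -
  have "map (digits b) xs = map (\<lambda>x. [x]) xs"
    using assms by (simp add: digits_less)
  then have "concat (map (digits b) xs) = xs"
    by (simp only: concat_map_singleton list.map_ident)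
  then show ?thesis
    by (simp only: juxtapose_def)
qed

text \<open>The induction goes from the right because \<open>digits\<close> splits off the last
  digit, while \<open>horner_sum\<close> expects the least significant digit first. A positive head
  excludes leading zeros, which the number could not remember.\<close>

lemma digits_horner_sum:
  assumes "xs \<noteq> []" and "hd xs > 0" and "\<forall>x\<in>set xs. x < b"
  shows "digits b (horner_sum id b (rev xs)) = xs"
  using assms
proof (induction xs rule: rev_induct)
  case (snoc x xs)
  show ?case
  proof (cases "xs = []")
    case True
    then show ?thesis using snoc.prems by (simp add: digits_less)
  next
    case False
    define h where "h = horner_sum id b (rev xs)"
    have IH: "digits b h = xs"
      unfolding h_def using snoc.prems False by (intro snoc.IH) simp_all
    have "hd xs > 0" and "hd xs < b" and "x < b"
      using snoc.prems False by auto
    then have "b \<ge> 2" by linarith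
    \<comment> \<open>If \<open>h\<close> were 0, its digit list \<open>xs\<close> would be
      \<open>[0]\<close>, against the positive head.\<close>
    have "h \<noteq> 0"
      using IH \<open>hd xs > 0\<close> digits_0[of b] by (metis less_irrefl list.sel(1))
    \<comment> \<open>So \<open>digits\<close> takes its recursive branch, where division by
      \<open>b\<close> returns \<open>h\<close> and the remainder \<open>x\<close>.\<close>
    then have "\<not> x + b * h < b" by (cases h) auto
    with IH \<open>x < b\<close> \<open>b \<ge> 2\<close> have "digits b (x + b * h) = xs @ [x]"
      by (subst digits.simps) simp
    then show ?thesis by (simp add: h_def id_def)
  qed
qed simp

text \<open>The head condition is guarded so that degree 0 is included: the empty word yields the
  number 0, whose digit list \<open>[0]\<close> is a palindrome.\<close>

lemma palindrome_juxtapose_iff: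
  assumes "xs \<noteq> [] \<Longrightarrow> hd xs > 0" and "\<forall>x\<in>set xs. x < b"
  shows "palindrome b (juxtapose b xs) \<longleftrightarrow> rev xs = xs"
proof (cases "xs = []")
  case True
  then show ?thesis by (simp add: palindrome_def juxtapose_def digits_0)
next
  case False
  then show ?thesis
    using assms by (simp add: palindrome_def juxtapose_digits digits_horner_sum)
qed

lemma sym_group_image_less:
  assumes "n < b" and "\<sigma> \<in> carrier (sym_group n)"
  shows "\<forall>x\<in>set (map \<sigma> [1..<Suc n]). x < b"
proof -
  have "\<sigma> ` {1..n} = {1..n}"
    using assms(2) by (simp add: sym_group_carrier permutes_image)
  then show ?thesis
    using assms(1) by (simp add: atLeastLessThanSuc_atLeastAtMost del: upt_Suc)
qed

text \<open>For \<open>n = 0\<close> the length condition makes \<open>ys\<close> empty too,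
  contradicting the first premise; otherwise the head is 1.\<close>

lemma hd_upt_append_pos: "[1..<Suc n] @ ys \<noteq> [] \<Longrightarrow> length ys = n \<Longrightarrow> hd ([1..<Suc n] @ ys) > 0"
  by (cases n) (auto simp: hd_append simp del: upt_Suc)

text \<open>Reversing \<open>w @ rev (map \<sigma> w)\<close> gives
  \<open>map \<sigma> w @ rev w\<close>, and words with halves of equal length can be compared half
  by half.\<close>

lemma PP_left_iff:
  assumes "n < b"
  shows "\<sigma> \<in> PP_left b n \<longleftrightarrow>
    \<sigma> \<in> carrier (sym_group n) \<and> map \<sigma> [1..<Suc n] = [1..<Suc n]"
proof (cases "\<sigma> \<in> carrier (sym_group n)")
  case True
  let ?w = "[1..<Suc n]"
  have "palindrome b (N_left b n \<sigma>) \<longleftrightarrow>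
      rev (?w @ rev (map \<sigma> ?w)) = ?w @ rev (map \<sigma> ?w)"
    unfolding N_left_def using assms sym_group_image_less[OF assms True]
    by (intro palindrome_juxtapose_iff hd_upt_append_pos) (auto simp del: upt_Suc)
  then show ?thesis
    using True by (auto simp: PP_left_def simp del: upt_Suc)
qed (simp add: PP_left_def)

lemma PP_right_iff:
  assumes "n < b"
  shows "\<sigma> \<in> PP_right b n \<longleftrightarrow>
    \<sigma> \<in> carrier (sym_group n) \<and> map \<sigma> [1..<Suc n] = rev [1..<Suc n]"
proof (cases "\<sigma> \<in> carrier (sym_group n)")
  case True
  let ?w = "[1..<Suc n]"
  have "palindrome b (N_right b n \<sigma>) \<longleftrightarrow>
      rev (?w @ map \<sigma> ?w) = ?w @ map \<sigma> ?w"
    unfolding N_right_def using assms sym_group_image_less[OF assms True]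
    by (intro palindrome_juxtapose_iff hd_upt_append_pos) (auto simp del: upt_Suc)
  \<comment> \<open>Here the halves give \<open>rev (map \<sigma> w) = w\<close> and
    \<open>rev w = map \<sigma> w\<close>, which are one equation up to reversal.\<close>
  also have "\<dots> \<longleftrightarrow> map \<sigma> ?w = rev ?w"
    by (auto simp: rev_swap simp del: upt_Suc)
  finally show ?thesis
    using True by (simp add: PP_right_def del: upt_Suc)
qed (simp add: PP_right_def)

lemma sym_group_inv_eq_self:
  assumes carr: "\<sigma> \<in> carrier (sym_group n)"
    and twice: "map \<sigma> (map \<sigma> [1..<Suc n]) = [1..<Suc n]"
  shows "inv\<^bsub>sym_group n\<^esub> \<sigma> = \<sigma>"
proof -
  have perm: "\<sigma> permutes {1..n}"
    using carr by (simp add: sym_group_carrier)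
  have "\<forall>x\<in>set [1..<Suc n]. (\<sigma> \<circ> \<sigma>) x = id x"
    using twice by (simp only: map_map map_eq_conv[symmetric] list.map_id)
  then have "(\<sigma> \<circ> \<sigma>) x = id x" if "x \<in> {1..n}" for x
    using that by (simp only: set_upt atLeastLessThanSuc_atLeastAtMost)
  \<comment> \<open>The word equation says nothing about these points; they are fixed because
    \<open>\<sigma>\<close> permutes \<open>{1..n}\<close>.\<close>
  moreover have "(\<sigma> \<circ> \<sigma>) x = id x" if "x \<notin> {1..n}" for x
    using permutes_not_in[OF perm that] by (simp only: o_apply id_apply)
  ultimately have "\<sigma> \<circ> \<sigma> = id" by (intro ext) metis
  then show ?thesis
    by (intro group.inv_equality[OF sym_group_is_group] carr)
       (simp add: sym_group_mult sym_group_one)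
qed

lemma PP_left_inv_eq_self:
  assumes "n < b" and "\<sigma> \<in> PP_left b n"
  shows "inv\<^bsub>sym_group n\<^esub> \<sigma> = \<sigma>"
proof (rule sym_group_inv_eq_self)
  show "\<sigma> \<in> carrier (sym_group n)" using assms by (simp add: PP_left_iff)
  have w: "map \<sigma> [1..<Suc n] = [1..<Suc n]" using assms by (simp only: PP_left_iff)
  show "map \<sigma> (map \<sigma> [1..<Suc n]) = [1..<Suc n]" by (simp only: w)
qed

lemma PP_right_inv_eq_self:
  assumes "n < b" and "\<sigma> \<in> PP_right b n"
  shows "inv\<^bsub>sym_group n\<^esub> \<sigma> = \<sigma>"
proof (rule sym_group_inv_eq_self)
  show "\<sigma> \<in> carrier (sym_group n)" using assms by (simp add: PP_right_iff)
  have w: "map \<sigma> [1..<Suc n] = rev [1..<Suc n]" using assms by (simp only: PP_right_iff)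
  \<comment> \<open>Since \<open>map\<close> commutes with \<open>rev\<close>, the second
    application reverses the word back.\<close>
  show "map \<sigma> (map \<sigma> [1..<Suc n]) = [1..<Suc n]"
    by (simp only: w rev_map[symmetric] rev_rev_ident)
qed

theorem theorem3p3:
  fixes n b :: nat and \<sigma> :: "nat \<Rightarrow> nat"
  assumes "n < b"
    and "\<sigma> \<in> carrier (sym_group n)"
  shows "(\<sigma> \<in> PP_left b n \<longleftrightarrow> inv\<^bsub>sym_group n\<^esub> \<sigma> \<in> PP_left b n) \<and>
         (\<sigma> \<in> PP_right b n \<longleftrightarrow> inv\<^bsub>sym_group n\<^esub> \<sigma> \<in> PP_right b n) \<and>
         \<one>\<^bsub>sym_group n\<^esub> \<in> PP_left b n"
proof -
  \<comment> \<open>For the converse directions: if the inverse is palindromic, it is its own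
    inverse, and this equation then identifies it with \<open>\<sigma>\<close>.\<close>
  have inv_inv: "inv\<^bsub>sym_group n\<^esub> (inv\<^bsub>sym_group n\<^esub> \<sigma>) = \<sigma>"
    using group.inv_inv[OF sym_group_is_group assms(2)] .
  have "\<one>\<^bsub>sym_group n\<^esub> \<in> PP_left b n"
    using assms(1) by (simp add: PP_left_iff sym_group_one sym_group_carrier del: upt_Suc)
  moreover have "\<sigma> \<in> PP_left b n \<longleftrightarrow> inv\<^bsub>sym_group n\<^esub> \<sigma> \<in> PP_left b n"
    using PP_left_inv_eq_self[OF assms(1)] inv_inv by metis
  moreover have "\<sigma> \<in> PP_right b n \<longleftrightarrow> inv\<^bsub>sym_group n\<^esub> \<sigma> \<in> PP_right b n"
    using PP_right_inv_eq_self[OF assms(1)] inv_inv by metis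
  ultimately show ?thesis by blast
qed

end
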